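(* Let $q\in(0,1)$. There does not exist a constant $C>0$ such that $$L_q(fg)\le C\cdot\big(L_q(f)\,\|g\|_\infty+\|f\|_\infty\, L_q(g)\big)\qquad\text{for all } f,g\in\mathcal{O}(S^1).$$
   Context: For $q\in(0,1)$ and $n\in\mathbb{Z}$ put $[n]_q := \frac{q^n-q^{-n}}{q-q^{-1}}$. $\mathcal{O}(S^1)\subseteq C(S^1)$ is the unital $*$-subalgebra generated by the inclusion $z:S^1\to\mathbb{C}$ of the unit circle; it has vector space basis $(z^n)_{n\in\mathbb{Z}}$. The $q$-derivative is the linear map $\mathrm{d}_q:\mathcal{O}(S^1)\to\mathcal{O}(S^1)$ with $\mathrm{d}_q(z^n)=i[n]_q z^n$, and $L_q(f):=\|\mathrm{d}_q(f)\|_\infty$ for $f\in\mathcal{O}(S^1)$, where $\|\cdot\|_\infty$ is the supremum norm on $C(S^1)$. *)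

theory Defs
  imports "HOL-Analysis.Analysis"
begin

typedef circle = "sphere (0::complex) 1"
  morphisms incl Abs_circle
  by (rule exI[of _ 1]) simp

instantiation circle :: metric_space
begin

definition dist_circle :: "circle \<Rightarrow> circle \<Rightarrow> real"
  where "dist_circle x y = dist (incl x) (incl y)"

definition uniformity_circle :: "(circle \<times> circle) filter"
  where "uniformity_circle = (INF e\<in>{0<..}. principal {(x, y). dist x y < e})"

definition open_circle :: "circle set \<Rightarrow> bool"
  where "open_circle U \<longleftrightarrow>
    (\<forall>x\<in>U. eventually (\<lambda>(x', y). x' = x \<longrightarrow> y \<in> U) uniformity)"

instance
proof
  fix x y z :: circle
  show "dist x y = 0 \<longleftrightarrow> x = y"
    by (simp add: dist_circle_def incl_inject)
  show "dist x y \<le> dist x z + dist y z"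
    unfolding dist_circle_def by (rule dist_triangle2)
qed (rule uniformity_circle_def open_circle_def)+

end

lemma norm_incl [simp]: "norm (incl x) = 1"
  using incl[of x] by simp

lemma incl_nonzero [simp]: "incl x \<noteq> 0"
  using norm_incl[of x] by fastforce

lemma cnj_incl: "cnj (incl x) = incl x powi (-1)"
  by (simp add: power_int_minus inverse_complex_def complex_eq_iff cmod_power2 [symmetric])

lemma continuous_on_incl: "continuous_on S incl"
  unfolding continuous_on_iff dist_circle_def by auto

text \<open>\<open>O_circle\<close> is the unital \<open>*\<close>-subalgebra of \<open>C(S\<^sup>1)\<close> generated by the inclusion
  \<open>incl\<close> (the function called \<open>z\<close> in the literature). The constant
  functions are the scalar multiples of the unit; together with closure under products they give closure
  under scalar multiplication.\<close>

inductive_set O_circle :: "(circle \<Rightarrow> complex) set" where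
  const: "(\<lambda>x. c) \<in> O_circle"
| incl: "incl \<in> O_circle"
| add: "\<lbrakk>f \<in> O_circle; g \<in> O_circle\<rbrakk> \<Longrightarrow> (\<lambda>x. f x + g x) \<in> O_circle"
| mult: "\<lbrakk>f \<in> O_circle; g \<in> O_circle\<rbrakk> \<Longrightarrow> (\<lambda>x. f x * g x) \<in> O_circle"
| star: "f \<in> O_circle \<Longrightarrow> (\<lambda>x. cnj (f x)) \<in> O_circle"

definition zpow :: "int \<Rightarrow> circle \<Rightarrow> complex"
  where "zpow n = (\<lambda>x. incl x powi n)"

definition sup_norm :: "(circle \<Rightarrow> complex) \<Rightarrow> real"
  where "sup_norm f = (SUP x. norm (f x))"

definition q_int :: "real \<Rightarrow> int \<Rightarrow> real"
  where "q_int q n = (q powi n - q powi (- n)) / (q - q powi (- 1))"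

definition is_q_derivative :: "real \<Rightarrow> ((circle \<Rightarrow> complex) \<Rightarrow> (circle \<Rightarrow> complex)) \<Rightarrow> bool"
  where "is_q_derivative q d \<longleftrightarrow>
    (\<forall>f\<in>O_circle. d f \<in> O_circle) \<and>
    (\<forall>f\<in>O_circle. \<forall>g\<in>O_circle. d (\<lambda>x. f x + g x) = (\<lambda>x. d f x + d g x)) \<and>
    (\<forall>c. \<forall>f\<in>O_circle. d (\<lambda>x. c * f x) = (\<lambda>x. c * d f x)) \<and>
    (\<forall>n. d (zpow n) = (\<lambda>x. \<i> * of_real (q_int q n) * zpow n x))"

text \<open>These conditions determine \<open>d\<close> on \<open>O_circle\<close>, and such a \<open>d\<close> exists; both facts are
  proved below. Values outside \<open>O_circle\<close> are irrelevant.\<close>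

definition q_deriv :: "real \<Rightarrow> (circle \<Rightarrow> complex) \<Rightarrow> (circle \<Rightarrow> complex)"
  where "q_deriv q = (SOME d. is_q_derivative q d)"

definition L_q :: "real \<Rightarrow> (circle \<Rightarrow> complex) \<Rightarrow> real"
  where "L_q q f = sup_norm (q_deriv q f)"


lemma O_circle_continuous: "f \<in> O_circle \<Longrightarrow> continuous_on UNIV f"
  by (induction rule: O_circle.induct) (auto intro!: continuous_intros continuous_on_incl)

lemma O_circle_bounded: "f \<in> O_circle \<Longrightarrow> bdd_above (range (\<lambda>x. norm (f x)))"
proof -
  assume "f \<in> O_circle"
  then have "\<exists>B. \<forall>x. norm (f x) \<le> B"
  proof (induction rule: O_circle.induct)
    case incl
    then show ?case by (intro exI[of _ 1]) simp
  next
    case (add f g)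
    then obtain A B where "\<And>x. norm (f x) \<le> A" "\<And>x. norm (g x) \<le> B" by blast
    then show ?case by (intro exI[of _ "A + B"]) (auto intro: norm_triangle_mono)
  next
    case (mult f g)
    then obtain A B where *: "\<And>x. norm (f x) \<le> A" "\<And>x. norm (g x) \<le> B" by blast
    have "norm (f x * g x) \<le> A * B" for x
      unfolding norm_mult using *[of x] norm_ge_zero order_trans by (intro mult_mono) blast+
    then show ?case by blast
  qed auto
  then show ?thesis by (auto simp: bdd_above_def)
qed

lemma O_circle_scale: "f \<in> O_circle \<Longrightarrow> (\<lambda>x. c * f x) \<in> O_circle"
  using O_circle.mult[OF O_circle.const] .

lemma O_circle_sum:
  assumes "\<And>n. n \<in> S \<Longrightarrow> f n \<in> O_circle"
  shows "(\<lambda>x. \<Sum>n\<in>S. f n x) \<in> O_circle"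
  using assms
  by (induction S rule: infinite_finite_induct) (auto intro: O_circle.const O_circle.add)

lemma zpow_nat_in_O_circle: "zpow (int n) \<in> O_circle"
proof (induction n)
  case 0
  then show ?case by (simp add: zpow_def O_circle.const)
next
  case (Suc n)
  then show ?case
    using O_circle.mult[OF O_circle.incl Suc] by (simp add: zpow_def power_int_add)
qed

lemma zpow_minus: "zpow (- n) = (\<lambda>x. cnj (zpow n x))"
  by (simp add: zpow_def cnj_incl power_int_minus flip: power_int_inverse)

lemma zpow_in_O_circle: "zpow n \<in> O_circle"
proof (cases n)
  case (nonneg m)
  then show ?thesis by (simp add: zpow_nat_in_O_circle)
next
  case (neg m)
  then show ?thesis
    using O_circle.star[OF zpow_nat_in_O_circle[of "Suc m"]] zpow_minus[of "int (Suc m)"] by simp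
qed

definition laurent :: "(int \<Rightarrow> complex) \<Rightarrow> circle \<Rightarrow> complex"
  where "laurent c = (\<lambda>x. \<Sum>n | c n \<noteq> 0. c n * zpow n x)"

lemma laurent_eq_sum:
  assumes "finite S" "{n. c n \<noteq> 0} \<subseteq> S"
  shows "laurent c = (\<lambda>x. \<Sum>n\<in>S. c n * zpow n x)"
  unfolding laurent_def using assms by (intro ext sum.mono_neutral_left) auto

lemma laurent_in_O_circle: "laurent c \<in> O_circle"
  unfolding laurent_def by (intro O_circle_sum O_circle_scale zpow_in_O_circle)

lemma laurent_add:
  assumes "finite {n. c n \<noteq> 0}" "finite {n. d n \<noteq> 0}"
  shows "laurent (\<lambda>n. c n + d n) = (\<lambda>x. laurent c x + laurent d x)"
proof -
  let ?S = "{n. c n \<noteq> 0} \<union> {n. d n \<noteq> 0}"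
  have "laurent c = (\<lambda>x. \<Sum>n\<in>?S. c n * zpow n x)" "laurent d = (\<lambda>x. \<Sum>n\<in>?S. d n * zpow n x)"
    "laurent (\<lambda>n. c n + d n) = (\<lambda>x. \<Sum>n\<in>?S. (c n + d n) * zpow n x)"
    using assms by (auto intro!: laurent_eq_sum)
  then show ?thesis by (simp add: sum.distrib algebra_simps)
qed

lemma laurent_mult:
  assumes "finite {n. c n \<noteq> 0}"
  shows "laurent (\<lambda>n. a n * c n) = (\<lambda>x. \<Sum>n | c n \<noteq> 0. a n * (c n * zpow n x))"
  using laurent_eq_sum[OF assms, of "\<lambda>n. a n * c n"] by (auto simp: mult.assoc)

lemma laurent_scale:
  assumes "finite {n. c n \<noteq> 0}"
  shows "laurent (\<lambda>n. a * c n) = (\<lambda>x. a * laurent c x)"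
  using laurent_mult[OF assms, of "\<lambda>_. a"] by (simp add: laurent_def sum_distrib_left)

lemma laurent_delta: "laurent (\<lambda>n. if n = m then a else 0) = (\<lambda>x. a * zpow m x)"
  by (subst laurent_eq_sum[of "{m}"]) auto

text \<open>The monomials \<open>zpow n\<close> form a basis of \<open>O_circle\<close>.\<close>

lemma O_circle_laurent:
  assumes "f \<in> O_circle"
  shows "\<exists>c. finite {n. c n \<noteq> 0} \<and> f = laurent c"
proof -
  let ?P = "\<lambda>f. \<exists>c. finite {n. c n \<noteq> 0} \<and> f = laurent c"
  have P_add: "?P (\<lambda>x. f x + g x)" if "?P f" "?P g" for f g
  proof -
    from that obtain c d where cd: "finite {n. c n \<noteq> 0}" "f = laurent c"
      "finite {n. d n \<noteq> 0}" "g = laurent d" by blast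
    have "finite {n. c n + d n \<noteq> 0}"
      by (rule finite_subset[of _ "{n. c n \<noteq> 0} \<union> {n. d n \<noteq> 0}"]) (use cd in auto)
    with laurent_add[of c d] cd show ?thesis by (intro exI[of _ "\<lambda>n. c n + d n"]) simp
  qed
  have P_mono: "?P (\<lambda>x. a * zpow m x)" for a m
    by (rule exI[of _ "\<lambda>n. if n = m then a else 0"]) (simp add: laurent_delta)
  have P_sum: "?P (\<lambda>x. \<Sum>n\<in>S. f n x)" if "\<And>n. n \<in> S \<Longrightarrow> ?P (f n)"
    for S and f :: "int \<Rightarrow> circle \<Rightarrow> complex"
    using that
  proof (induction S rule: infinite_finite_induct)
    case (insert y S)
    have "?P (\<lambda>x. f y x + (\<Sum>n\<in>S. f n x))"
      by (rule P_add) (use insert in auto)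
    with insert(1,2) show ?case by simp
  qed (use P_mono[of 0 0] in simp_all)
  show ?thesis
    using assms
  proof (induction rule: O_circle.induct)
    case (const c)
    then show ?case using P_mono[of c 0] by (simp add: zpow_def)
  next
    case incl
    then show ?case using P_mono[of 1 1] by (simp add: zpow_def)
  next
    case (add f g)
    then show ?case by (intro P_add)
  next
    case (mult f g)
    then obtain c d where cd: "f = laurent c" "g = laurent d" by blast
    have "(\<lambda>x. f x * g x) =
      (\<lambda>x. \<Sum>n | c n \<noteq> 0. \<Sum>m | d m \<noteq> 0. (c n * d m) * zpow (n + m) x)"
      by (simp add: cd laurent_def sum_product zpow_def power_int_add algebra_simps)
    moreover have "?P \<dots>" by (intro P_sum P_mono)
    ultimately show ?case by simp
  next
    case (star f)
    then obtain c where c: "f = laurent c" by blast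
    have "(\<lambda>x. cnj (f x)) = (\<lambda>x. \<Sum>n | c n \<noteq> 0. cnj (c n) * zpow (- n) x)"
      by (simp add: c laurent_def zpow_minus)
    moreover have "?P \<dots>" by (intro P_sum P_mono)
    ultimately show ?case by simp
  qed
qed

lemma laurent_eq_0:
  assumes fin: "finite {n. c n \<noteq> 0}" and eq: "laurent c = (\<lambda>x. 0)"
  shows "c n = 0"
proof (rule ccontr)
  assume "c n \<noteq> 0"
  obtain N where N: "\<And>k. c k \<noteq> 0 \<Longrightarrow> \<bar>k\<bar> \<le> int N"
  proof -
    have "\<bar>k\<bar> \<le> int (nat (\<Sum>k | c k \<noteq> 0. \<bar>k\<bar>))" if "c k \<noteq> 0" for k
      using member_le_sum[of k "{k. c k \<noteq> 0}" abs] fin that by (simp add: sum_nonneg)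
    then show ?thesis using that by blast
  qed
  define b where "b j = c (int j - int N)" for j
  have zero: "(\<Sum>j\<le>2 * N. b j * incl x ^ j) = 0" for x
  proof -
    have "(\<Sum>j\<le>2 * N. b j * incl x ^ j)
        = (\<Sum>k\<in>{- int N..int N}. incl x powi int N * (c k * zpow k x))"
    proof (rule sum.reindex_bij_witness[of _ "\<lambda>k. nat (k + int N)" "\<lambda>j. int j - int N"])
      fix j assume "j \<in> {..2 * N}"
      have "incl x powi int N * zpow (int j - int N) x = incl x ^ j"
        using power_int_add[of "incl x" "int N" "int j - int N"] by (simp add: zpow_def)
      then show "incl x powi int N * (c (int j - int N) * zpow (int j - int N) x)
        = b j * incl x ^ j" by (simp add: b_def algebra_simps)
    qed auto
    also have "\<dots> = incl x powi int N * laurent c x"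
      using N by (subst laurent_eq_sum[of "{- int N..int N}"]) (force simp: sum_distrib_left)+
    finally show ?thesis using eq by simp
  qed
  have "b (nat (n + int N)) \<noteq> 0" "nat (n + int N) \<le> 2 * N"
    using \<open>c n \<noteq> 0\<close> N[of n] by (auto simp: b_def)
  then have "finite {w. (\<Sum>j\<le>2 * N. b j * w ^ j) = 0}"
    using polyfun_finite_roots[of b "2 * N"] by blast
  moreover have "sphere (0::complex) 1 \<subseteq> {w. (\<Sum>j\<le>2 * N. b j * w ^ j) = 0}"
  proof
    fix w :: complex assume "w \<in> sphere 0 1"
    then show "w \<in> {w. (\<Sum>j\<le>2 * N. b j * w ^ j) = 0}"
      using zero[of "Abs_circle w"] by (simp add: Abs_circle_inverse)
  qed
  moreover have "infinite (sphere (0::complex) 1)"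
  proof
    assume "finite (sphere (0::complex) 1)"
    moreover have "connected (sphere (0::complex) 1)"
      by (rule connected_sphere) simp
    ultimately have "sphere (0::complex) 1 = {} \<or> (\<exists>a. sphere (0::complex) 1 = {a})"
      by (simp only: connected_finite_iff_sing)
    moreover have "1 \<in> sphere (0::complex) 1" "- 1 \<in> sphere (0::complex) 1" by simp_all
    ultimately have "(1::complex) = - 1" by (metis empty_iff singletonD)
    then show False by simp
  qed
  ultimately show False using finite_subset by blast
qed

lemma laurent_inject:
  assumes "finite {n. c n \<noteq> 0}" "finite {n. d n \<noteq> 0}" "laurent c = laurent d"
  shows "c = d"
proof
  fix n
  have fin: "finite {n. - 1 * d n \<noteq> 0}" using assms by simp
  have "laurent (\<lambda>n. c n + - 1 * d n) = (\<lambda>x. 0)"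
    using laurent_add[OF assms(1) fin] laurent_scale[OF assms(2), of "- 1"] assms(3) by simp
  moreover have "finite {n. c n + - 1 * d n \<noteq> 0}"
    by (rule finite_subset[of _ "{n. c n \<noteq> 0} \<union> {n. d n \<noteq> 0}"]) (use assms in auto)
  ultimately show "c n = d n" using laurent_eq_0[of "\<lambda>n. c n + - 1 * d n" n] by simp
qed

lemma is_q_derivative_laurent:
  assumes "is_q_derivative q d" "finite {n. c n \<noteq> 0}"
  shows "d (laurent c) = laurent (\<lambda>n. (\<i> * of_real (q_int q n)) * c n)"
proof -
  have d_add: "d (\<lambda>x. f x + g x) = (\<lambda>x. d f x + d g x)"
    if "f \<in> O_circle" "g \<in> O_circle" for f g
    using assms that by (simp add: is_q_derivative_def)
  have d_scale: "d (\<lambda>x. a * f x) = (\<lambda>x. a * d f x)" if "f \<in> O_circle" for a f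
    using assms that by (simp add: is_q_derivative_def)
  have d_zpow: "d (zpow n) = (\<lambda>x. \<i> * of_real (q_int q n) * zpow n x)" for n
    using assms by (simp add: is_q_derivative_def)
  have "d (\<lambda>x. \<Sum>n\<in>S. c n * zpow n x)
      = (\<lambda>x. \<Sum>n\<in>S. \<i> * of_real (q_int q n) * (c n * zpow n x))"
    if "finite S" for S
    using that
  proof (induction S)
    case empty
    then show ?case using d_scale[OF zpow_in_O_circle[of 0], of 0] by simp
  next
    case (insert m S)
    have "(\<lambda>x. \<Sum>n\<in>S. c n * zpow n x) \<in> O_circle"
      by (intro O_circle_sum O_circle_scale zpow_in_O_circle)
    from d_add[OF O_circle_scale[OF zpow_in_O_circle] this, of "c m" m]
    have "d (\<lambda>x. c m * zpow m x + (\<Sum>n\<in>S. c n * zpow n x))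
        = (\<lambda>x. c m * (\<i> * of_real (q_int q m) * zpow m x)
            + (\<Sum>n\<in>S. \<i> * of_real (q_int q n) * (c n * zpow n x)))"
      by (simp only: d_scale[OF zpow_in_O_circle] d_zpow insert.IH)
    then show ?case
      using insert.hyps by (simp add: mult.left_commute mult.assoc)
  qed
  from this[OF assms(2)] show ?thesis
    using assms(2) by (simp add: laurent_mult) (simp add: laurent_def)
qed

lemma is_q_derivative_unique:
  assumes "is_q_derivative q d" "is_q_derivative q d'" "f \<in> O_circle"
  shows "d f = d' f"
  using O_circle_laurent[OF assms(3)] is_q_derivative_laurent[OF assms(1)]
    is_q_derivative_laurent[OF assms(2)] by auto

lemma is_q_derivative_ex: "\<exists>d. is_q_derivative q d"
proof -
  define cf where "cf f = (THE c. finite {n. c n \<noteq> 0} \<and> f = laurent c)" for f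
  have cf: "cf (laurent c) = c" if "finite {n. c n \<noteq> 0}" for c
    unfolding cf_def using that laurent_inject by (intro the_equality) auto
  let ?a = "\<lambda>n::int. \<i> * of_real (q_int q n)"
  define d where "d f = laurent (\<lambda>n. ?a n * cf f n)" for f
  have d: "d (laurent c) = (\<lambda>x. \<Sum>n | c n \<noteq> 0. ?a n * (c n * zpow n x))"
      "d (laurent c) = laurent (\<lambda>n. ?a n * c n)"
    if "finite {n. c n \<noteq> 0}" for c
    using that by (simp_all add: d_def cf laurent_mult)
  have fin: "finite {n. ?a n * c n \<noteq> 0}" if "finite {n. c n \<noteq> 0}" for c :: "int \<Rightarrow> complex"
    using that by (rule finite_subset[rotated]) auto
  have "is_q_derivative q d"
    unfolding is_q_derivative_def
  proof (intro conjI ballI allI)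
    fix f g assume "f \<in> O_circle" "g \<in> O_circle"
    then obtain b c where bc: "finite {n. b n \<noteq> 0}" "f = laurent b"
      "finite {n. c n \<noteq> 0}" "g = laurent c" using O_circle_laurent by metis
    have "finite {n. b n + c n \<noteq> 0}"
      by (rule finite_subset[of _ "{n. b n \<noteq> 0} \<union> {n. c n \<noteq> 0}"]) (use bc in auto)
    then have "d (\<lambda>x. f x + g x) = laurent (\<lambda>n. ?a n * (b n + c n))"
      using d(2) laurent_add[OF bc(1,3)] bc(2,4) by metis
    also have "\<dots> = laurent (\<lambda>n. ?a n * b n + ?a n * c n)" by (simp add: algebra_simps)
    also have "\<dots> = (\<lambda>x. d f x + d g x)"
      unfolding bc(2,4) using laurent_add[OF fin[OF bc(1)] fin[OF bc(3)]] d(2) bc by metis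
    finally show "d (\<lambda>x. f x + g x) = (\<lambda>x. d f x + d g x)" .
  next
    fix a f assume "f \<in> O_circle"
    then obtain c where c: "finite {n. c n \<noteq> 0}" "f = laurent c"
      using O_circle_laurent by metis
    have "finite {n. a * c n \<noteq> 0}"
      using c(1) by (rule finite_subset[rotated]) auto
    then have "d (\<lambda>x. a * f x) = laurent (\<lambda>n. ?a n * (a * c n))"
      using d(2) laurent_scale[OF c(1)] c(2) by metis
    also have "\<dots> = laurent (\<lambda>n. a * (?a n * c n))" by (simp add: algebra_simps)
    also have "\<dots> = (\<lambda>x. a * d f x)"
      unfolding c(2) using laurent_scale[OF fin[OF c(1)]] d(2) c by metis
    finally show "d (\<lambda>x. a * f x) = (\<lambda>x. a * d f x)" .
  next
    fix m
    let ?c = "\<lambda>n::int. if n = m then 1 else 0 :: complex"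
    have "zpow m = laurent ?c" by (simp add: laurent_delta)
    moreover have "finite {n. ?c n \<noteq> 0}" by simp
    moreover have "(\<lambda>n. ?a n * ?c n) = (\<lambda>n. if n = m then ?a m else 0)" by auto
    ultimately show "d (zpow m) = (\<lambda>x. ?a m * zpow m x)"
      using d(2)[of ?c] laurent_delta[of m "?a m"] by simp
  next
    fix f show "d f \<in> O_circle" unfolding d_def by (rule laurent_in_O_circle)
  qed
  then show ?thesis by (rule exI[of _ d])
qed

lemma is_q_derivative_q_deriv: "is_q_derivative q (q_deriv q)"
  unfolding q_deriv_def using is_q_derivative_ex by (rule someI_ex)

end

theory Submission
  imports Defs
begin

text \<open>The twisted Leibniz rule for \<open>d\<^sub>q\<close> involves the dilation
  \<open>f(z) \<mapsto> f(q z)\<close>, and this dilation is not controlled by \<open>\<parallel>f\<parallel>\<close> and \<open>L\<^sub>q(f)\<close>. Indeed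
  \<open>d\<^sub>q f\<close> is a multiple of \<open>f(q z) - f(z / q)\<close>, and in terms of Fourier coefficients the passage from this
  difference to \<open>f(q z)\<close> is, apart from the constant term and an exponentially decaying error, the
  projection onto the negative frequencies. That projection is unbounded in the supremum norm, the standard witness being
  \<open>\<Sum> sin (n \<theta>) / n\<close>: it is bounded, but separating the frequencies of different sign produces
  the harmonic series.

  It is enough to take \<open>g = z\<close>. Put
  \<open>f = (\<Sum>n=1..N. r\<^sup>n / (n [n]\<^sub>q) (z\<^sup>n + z\<^sup>-\<^sup>n))\<close> with \<open>r < 1\<close>. The \<open>q\<close>-integers grow geometrically, so
  \<open>\<parallel>f\<parallel>\<close> is bounded independently of \<open>r\<close> and \<open>N\<close>. Applying \<open>d\<^sub>q\<close> cancels \<open>[n]\<^sub>q\<close> and gives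
  \<open>-2 \<Sum> r\<^sup>n sin (n \<theta>) / n\<close>, which for large \<open>N\<close> is close to \<open>2 Im (Ln (1 - r z))\<close> and hence bounded.
  But at \<open>z = 1\<close> the modulus of \<open>d\<^sub>q (z f)\<close> is
  \<open>\<Sum> r\<^sup>n / n \<cdot> ([n + 1]\<^sub>q - [n - 1]\<^sub>q) / [n]\<^sub>q \<ge> (1 / q - q) \<Sum> r\<^sup>n / n\<close>, which tends to infinity as
  \<open>N \<rightarrow> \<infinity>\<close> and then \<open>r \<rightarrow> 1\<close>.\<close>

section \<open>Bounded sine sums with large conjugate sums\<close>

lemma neg_Ln_one_minus_sums:
  fixes z :: complex
  assumes "norm z < 1"
  shows "(\<lambda>n. z ^ Suc n / of_nat (Suc n)) sums (- Ln (1 - z))"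
proof -
  have "(\<lambda>n. - ((- (- z)) ^ n) / of_nat n) sums Ln (1 + (- z))"
    by (rule Ln_series') (use assms in simp)
  then have "(\<lambda>n. z ^ n / of_nat n) sums (- Ln (1 - z))"
    using sums_minus by fastforce
  then show ?thesis
    by (subst (asm) sums_Suc_iff[symmetric, of "\<lambda>n. z ^ n / of_nat n", simplified]) simp
qed

lemma sum_Suc_shift: "(\<Sum>n=1..N. h n) = (\<Sum>n<N. h (Suc n))"
  by (metis One_nat_def sum.atLeast1_atMost_eq lessThan_atLeast0)

text \<open>The Taylor polynomials of \<open>- Ln (1 - w)\<close> on the circle of radius \<open>r\<close> have this property:
  the imaginary part of the logarithm is at most \<open>\<pi>\<close>, its value at \<open>w = r\<close> is large for \<open>r\<close> near
  1, and since the coefficients are positive, the truncation error on the circle is largest at \<open>w = r\<close>.\<close>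

lemma bounded_sine_sum_large_cosine_sum:
  fixes M :: real
  obtains r :: real and N :: nat where "0 \<le> r" "r < 1"
    "(\<Sum>n=1..N. r ^ n / n) > M"
    "\<And>w. norm w = 1 \<Longrightarrow> \<bar>Im (\<Sum>n=1..N. of_real (r ^ n / n) * w ^ n)\<bar> \<le> pi + 1"
proof -
  (* With this r the full series at w = r sums to exactly K. The truncation at N loses less than 1,
     which accounts for the excess of K over M and for the 1 added to pi. *)
  define K where "K = max M 0 + 1"
  define r :: real where "r = 1 - exp (- K)"
  have r: "0 \<le> r" "r < 1" by (auto simp: r_def K_def)
  define t where "t n = r ^ Suc n / real (Suc n)" for n
  have "Ln (1 - of_real r) = of_real (- K)"
    by (simp add: r_def exp_of_real flip: exp_of_real of_real_minus)
  with neg_Ln_one_minus_sums[of "of_real r"] r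
  have "(\<lambda>n. of_real (t n) :: complex) sums of_real K"
    by (simp add: t_def)
  then have t: "t sums K" by (simp only: sums_of_real_iff)
  then have "(\<lambda>N. \<Sum>n<N. t n) \<longlonglongrightarrow> K" by (simp add: sums_def)
  then have "eventually (\<lambda>N. (\<Sum>n<N. t n) > K - 1) sequentially"
    by (rule order_tendstoD) simp
  then obtain N where N: "(\<Sum>n<N. t n) > K - 1"
    by (auto simp: eventually_sequentially)
  show ?thesis
  proof (rule that[OF r])
    show "(\<Sum>n=1..N. r ^ n / n) > M"
      using N unfolding sum_Suc_shift by (simp add: t_def K_def)
  next
    fix w :: complex assume w: "norm w = 1"
    define z where "z = of_real r * w"
    define u where "u n = z ^ Suc n / of_nat (Suc n)" for n
    have z: "norm z < 1" using r w by (simp add: z_def norm_mult)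
    have u: "u sums (- Ln (1 - z))"
      unfolding u_def by (rule neg_Ln_one_minus_sums[OF z])
    have norm_u: "norm (u n) = t n" for n
      using r w by (simp add: u_def z_def t_def norm_mult norm_divide norm_power power_mult_distrib
          del: of_nat_Suc power_Suc)
    have tail_t: "(\<lambda>n. t (n + N)) sums (K - (\<Sum>n<N. t n))"
      using t by (rule sums_split_initial_segment)
    have tail_u: "(\<lambda>n. u (n + N)) sums (- Ln (1 - z) - (\<Sum>n<N. u n))"
      using u by (rule sums_split_initial_segment)
    have "norm (- Ln (1 - z) - (\<Sum>n<N. u n)) \<le> K - (\<Sum>n<N. t n)"
      using norm_suminf_le[of "\<lambda>n. u (n + N)" "\<lambda>n. t (n + N)"] tail_t tail_u
      by (simp add: norm_u sums_iff)
    then have "\<bar>Im (- Ln (1 - z) - (\<Sum>n<N. u n))\<bar> < 1"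
      using abs_Im_le_cmod[of "- Ln (1 - z) - (\<Sum>n<N. u n)"] N by linarith
    moreover have "1 - z \<noteq> 0" using z by auto
    then have "\<bar>Im (Ln (1 - z))\<bar> \<le> pi"
      using Im_Ln_le_pi[of "1 - z"] mpi_less_Im_Ln[of "1 - z"] by auto
    ultimately have "\<bar>Im (\<Sum>n<N. u n)\<bar> \<le> pi + 1"
      by (simp only: minus_complex.sel uminus_complex.sel)
    moreover have "(\<Sum>n=1..N. of_real (r ^ n / n) * w ^ n) = (\<Sum>n<N. u n)"
      unfolding sum_Suc_shift
      by (simp add: u_def z_def power_mult_distrib del: of_nat_Suc power_Suc)
    ultimately show "\<bar>Im (\<Sum>n=1..N. of_real (r ^ n / n) * w ^ n)\<bar> \<le> pi + 1" by simp
  qed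
qed

section \<open>The \<open>q\<close>-integers\<close>

lemma less_reciprocal:
  fixes q :: real
  assumes "0 < q" "q < 1"
  shows "q < 1 / q"
proof -
  have "1 < 1 / q" using assms by simp
  then show ?thesis using assms by linarith
qed

lemma q_int_minus: "q_int q (- n) = - q_int q n"
  by (simp add: q_int_def minus_divide_left)

lemma q_int_1:
  assumes "0 < q" "q < 1"
  shows "q_int q 1 = 1"
proof -
  have "inverse q > 1" using assms by (simp add: one_less_inverse_iff)
  then show ?thesis using assms by (simp add: q_int_def power_int_minus)
qed

lemma q_int_ge:
  assumes "0 < q" "q < 1"
  shows "q_int q (int (Suc n)) \<ge> (1 / q) ^ n"
proof -
  have "(1 / q - q) * (1 / q) ^ n \<le> (1 / q) ^ Suc n - q ^ Suc n"
  proof -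
    have "q * q ^ n \<le> q * (1 / q) ^ n"
      using assms by (intro mult_left_mono power_mono) (auto simp: field_simps mult_le_one)
    then show ?thesis by (simp add: algebra_simps)
  qed
  moreover have "q_int q (int (Suc n)) = ((1 / q) ^ Suc n - q ^ Suc n) / (1 / q - q)"
  proof -
    have "q_int q (int (Suc n)) = (q ^ Suc n - (1 / q) ^ Suc n) / (q - 1 / q)"
      unfolding q_int_def power_int_minus power_int_of_nat power_int_1_right
      by (simp add: inverse_eq_divide power_one_over del: power_Suc)
    then show ?thesis by (metis minus_diff_eq minus_divide_divide)
  qed
  moreover have "1 / q - q > 0"
    using less_reciprocal[OF assms] by simp
  ultimately show ?thesis by (simp add: pos_le_divide_eq mult.commute)
qed

text \<open>The right-hand side equals \<open>q\<^sup>-\<^sup>n + q\<^sup>n\<close>, the left-hand side \<open>q\<^sup>-\<^sup>n - q\<^sup>n\<close>. The summand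
  \<open>[1 - n]\<^sub>q = - [n - 1]\<^sub>q\<close> has the form in which it arises from \<open>z \<cdot> z\<^sup>-\<^sup>n\<close>. Since \<open>[n]\<^sub>q\<close> grows
  geometrically, its increments are comparable to \<open>[n]\<^sub>q\<close> itself, unlike those of the classical
  multiplier \<open>n\<close>; this is what destroys the Leibniz inequality.\<close>

lemma q_int_diff_ge:
  assumes "0 < q" "q < 1"
  shows "(1 / q - q) * q_int q n \<le> q_int q (n + 1) + q_int q (1 - n)"
proof -
  have q: "q < 1 / q" "q \<noteq> 0"
    using less_reciprocal[OF assms] assms by simp_all
  define a where "a = q powi n"
  define b where "b = q powi (- n)"
  have "q_int q n = (b - a) / (1 / q - q)"
    unfolding q_int_def a_def b_def power_int_minus[of q 1] power_int_1_right inverse_eq_divide[of q]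
    by (metis minus_diff_eq minus_divide_divide)
  then have "(1 / q - q) * q_int q n = b - a"
    using q by simp
  also have "\<dots> \<le> b + a" using assms by (simp add: a_def)
  also have "\<dots> = q_int q (n + 1) + q_int q (1 - n)"
  proof -
    have e: "q powi (n + 1) = a * q" "q powi (- n - 1) = b / q"
      "q powi (1 - n) = b * q" "q powi (n - 1) = a / q"
      using q power_int_add[of q n 1] power_int_diff[of q "- n" 1]
        power_int_add[of q "- n" 1] power_int_diff[of q n 1]
      by (simp_all add: a_def b_def algebra_simps)
    have "q_int q (n + 1) + q_int q (1 - n) = ((a + b) * (q - 1 / q)) / (q - 1 / q)"
      unfolding q_int_def minus_add_distrib add_uminus_conv_diff minus_diff_eq e
      by (simp add: power_int_minus[of q 1] inverse_eq_divide add_divide_distrib[symmetric] algebra_simps)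
    then show ?thesis using q by simp
  qed
  finally show ?thesis .
qed

section \<open>Supremum norm and \<open>q\<close>-derivative on Laurent polynomials\<close>

lemma norm_le_sup_norm: "f \<in> O_circle \<Longrightarrow> norm (f x) \<le> sup_norm f"
  unfolding sup_norm_def using O_circle_bounded by (intro cSUP_upper) auto

lemma sup_norm_le: "(\<And>x. norm (f x) \<le> B) \<Longrightarrow> sup_norm f \<le> B"
  unfolding sup_norm_def by (intro cSUP_least) auto

lemma norm_zpow [simp]: "norm (zpow n x) = 1"
  by (simp add: zpow_def norm_power_int)

lemma q_deriv_in_O_circle: "f \<in> O_circle \<Longrightarrow> q_deriv q f \<in> O_circle"
  using is_q_derivative_q_deriv[of q] by (simp add: is_q_derivative_def)

lemma q_deriv_add:
  "f \<in> O_circle \<Longrightarrow> g \<in> O_circle \<Longrightarrow> q_deriv q (\<lambda>x. f x + g x) = (\<lambda>x. q_deriv q f x + q_deriv q g x)"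
  using is_q_derivative_q_deriv[of q] by (simp add: is_q_derivative_def)

lemma q_deriv_scale:
  "f \<in> O_circle \<Longrightarrow> q_deriv q (\<lambda>x. c * f x) = (\<lambda>x. c * q_deriv q f x)"
  using is_q_derivative_q_deriv[of q] by (simp add: is_q_derivative_def)

lemma q_deriv_zpow: "q_deriv q (zpow n) = (\<lambda>x. \<i> * of_real (q_int q n) * zpow n x)"
  using is_q_derivative_q_deriv[of q] by (simp add: is_q_derivative_def)

lemma q_deriv_sum:
  assumes "finite S" "\<And>n. n \<in> S \<Longrightarrow> f n \<in> O_circle"
  shows "q_deriv q (\<lambda>x. \<Sum>n\<in>S. f n x) = (\<lambda>x. \<Sum>n\<in>S. q_deriv q (f n) x)"
  using assms
proof (induction S)
  case empty
  show ?case using q_deriv_scale[OF O_circle.const[of 0], of q 0] by simp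
next
  case (insert m S)
  then show ?case
    using q_deriv_add[of "f m" "\<lambda>x. \<Sum>n\<in>S. f n x" q] by (simp add: O_circle_sum)
qed

text \<open>Both \<open>f\<close> and \<open>z f\<close> in the counterexample are of this form.\<close>

lemma q_deriv_binomial_sum:
  assumes "finite S"
  shows "q_deriv q (\<lambda>x. \<Sum>n\<in>S. a n * (zpow (k n) x + zpow (l n) x)) =
    (\<lambda>x. \<Sum>n\<in>S. a n * (\<i> * of_real (q_int q (k n)) * zpow (k n) x +
      \<i> * of_real (q_int q (l n)) * zpow (l n) x))"
proof -
  have "q_deriv q (\<lambda>x. a n * (zpow (k n) x + zpow (l n) x)) =
      (\<lambda>x. a n * (\<i> * of_real (q_int q (k n)) * zpow (k n) x +
        \<i> * of_real (q_int q (l n)) * zpow (l n) x))" for n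
    by (subst q_deriv_scale)
      (simp_all add: O_circle.add zpow_in_O_circle q_deriv_add q_deriv_zpow)
  then show ?thesis
    using assms by (subst q_deriv_sum) (simp_all add: O_circle_scale O_circle.add zpow_in_O_circle)
qed

section \<open>Failure of the Leibniz inequality\<close>

theorem lemma6p15:
  fixes q :: real
  assumes "0 < q" and "q < 1"
  shows "\<not> (\<exists>C::real. C > 0 \<and>
    (\<forall>f\<in>O_circle. \<forall>g\<in>O_circle.
      L_q q (\<lambda>x. f x * g x) \<le> C * (L_q q f * sup_norm g + sup_norm f * L_q q g)))"
proof
  assume "\<exists>C::real. C > 0 \<and>
    (\<forall>f\<in>O_circle. \<forall>g\<in>O_circle.
      L_q q (\<lambda>x. f x * g x) \<le> C * (L_q q f * sup_norm g + sup_norm f * L_q q g))"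
  then obtain C :: real where C: "C > 0"
    and leibniz: "\<And>f g. f \<in> O_circle \<Longrightarrow> g \<in> O_circle \<Longrightarrow>
      L_q q (\<lambda>x. f x * g x) \<le> C * (L_q q f * sup_norm g + sup_norm f * L_q q g)"
    by blast
  define \<delta> where "\<delta> = 1 / q - q"
  have \<delta>: "\<delta> > 0"
    using less_reciprocal[OF assms] by (simp add: \<delta>_def)
  define B where "B = 2 * (pi + 1) + 2 / (1 - q)"
  obtain r :: real and N :: nat where r: "0 \<le> r" "r < 1"
    and large: "(\<Sum>n=1..N. r ^ n / n) > C * B / \<delta>"
    and small: "\<And>w. norm w = 1 \<Longrightarrow> \<bar>Im (\<Sum>n=1..N. of_real (r ^ n / n) * w ^ n)\<bar> \<le> pi + 1"
    using bounded_sine_sum_large_cosine_sum[of "C * B / \<delta>"] by blast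
  define b where "b n = r ^ n / n" for n :: nat
  define a where "a n = b n / q_int q (int n)" for n :: nat
  define f where "f x = (\<Sum>n=1..N. of_real (a n) * (zpow (int n) x + zpow (- int n) x))" for x
  have f: "f \<in> O_circle"
    unfolding f_def by (intro O_circle_sum O_circle_scale O_circle.add zpow_in_O_circle)
  have b: "0 \<le> b n" "b n \<le> 1" for n
  proof -
    show "0 \<le> b n" using r by (simp add: b_def)
    show "b n \<le> 1"
    proof (cases "n = 0")
      case False
      have "r ^ n \<le> 1" using r by (simp add: power_le_one)
      with False show ?thesis by (simp add: b_def divide_le_eq)
    qed (simp add: b_def)
  qed
  have q_int_pos: "q_int q (int (Suc n)) > 0" for n
    using q_int_ge[OF assms, of n] assms by (smt (verit) zero_less_power zero_less_divide_1_iff)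
  have a_b: "a n * q_int q (int n) = b n" and a_nonneg: "0 \<le> a n" if "n \<in> {1..N}" for n
    using q_int_pos[of "n - 1"] b[of n] that by (simp_all add: a_def)

  have "sup_norm f \<le> 2 / (1 - q)"
  proof (rule sup_norm_le)
    fix x
    have a_le: "\<bar>a (Suc n)\<bar> \<le> q ^ n" for n
    proof -
      have "\<bar>a (Suc n)\<bar> = b (Suc n) / q_int q (int (Suc n))"
        using b[of "Suc n"] q_int_pos[of n] by (simp add: a_def)
      also have "\<dots> \<le> 1 / (1 / q) ^ n"
        using b[of "Suc n"] q_int_ge[OF assms, of n] assms by (intro frac_le) auto
      finally show ?thesis by (simp add: power_one_over)
    qed
    have "norm (f x) \<le> (\<Sum>n=1..N. \<bar>a n\<bar> * 2)"
      unfolding f_def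
    proof (rule sum_norm_le)
      fix n
      have "norm (zpow (int n) x + zpow (- int n) x) \<le> 1 + 1"
        by (rule norm_triangle_mono) simp_all
      then show "norm (of_real (a n) * (zpow (int n) x + zpow (- int n) x)) \<le> \<bar>a n\<bar> * 2"
        unfolding norm_mult norm_of_real by (intro mult_left_mono) simp_all
    qed
    also have "\<dots> = 2 * (\<Sum>n<N. \<bar>a (Suc n)\<bar>)"
      unfolding sum_Suc_shift by (simp add: sum_distrib_left mult.commute)
    also have "\<dots> \<le> 2 * (\<Sum>n<N. q ^ n)"
      by (intro mult_left_mono sum_mono a_le) simp
    also have "(\<Sum>n<N. q ^ n) \<le> (\<Sum>n. q ^ n)"
      using assms by (intro sum_le_suminf summable_geometric) auto
    also have "(\<Sum>n. q ^ n) = 1 / (1 - q)"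
      using assms by (intro suminf_geometric) auto
    finally show "norm (f x) \<le> 2 / (1 - q)" by simp
  qed

  moreover have "L_q q f \<le> 2 * (pi + 1)"
    unfolding L_q_def
  proof (rule sup_norm_le)
    fix x
    define s where "s = (\<Sum>n=1..N. of_real (b n) * incl x ^ n)"
    have "q_deriv q f x = (\<Sum>n=1..N. \<i> * of_real (b n) * (zpow (int n) x - zpow (- int n) x))"
      unfolding f_def
      by (subst q_deriv_binomial_sum)
        (auto intro!: sum.cong simp: q_int_minus a_b[symmetric] algebra_simps)
    also have "\<dots> = \<i> * (s - cnj s)"
      unfolding zpow_minus by (simp add: s_def zpow_def sum_distrib_left sum_subtractf algebra_simps)
    also have "norm \<dots> = 2 * \<bar>Im s\<bar>"
      by (simp add: complex_diff_cnj norm_mult)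
    finally show "norm (q_deriv q f x) \<le> 2 * (pi + 1)"
      using small[of "incl x"] by (simp add: s_def b_def)
  qed

  moreover have "L_q q (zpow 1) = 1" "sup_norm (zpow 1) = 1"
    using assms by (simp_all add: L_q_def sup_norm_def q_deriv_zpow q_int_1 norm_mult)

  moreover have "\<delta> * (\<Sum>n=1..N. b n) \<le> L_q q (\<lambda>x. f x * zpow 1 x)"
  proof -
    (* At the point 1 of the circle all terms of the derivative have the same phase. *)
    define p where "p = Abs_circle 1"
    have p: "zpow n p = 1" for n
      by (simp add: p_def zpow_def Abs_circle_inverse)
    have prod: "(\<lambda>x. f x * zpow 1 x) =
        (\<lambda>x. \<Sum>n=1..N. of_real (a n) * (zpow (int n + 1) x + zpow (1 - int n) x))"
      unfolding f_def sum_distrib_right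
      by (intro ext sum.cong)
        (simp_all add: zpow_def power_int_add power_int_diff power_int_minus divide_simps algebra_simps)
    have "q_deriv q (\<lambda>x. f x * zpow 1 x) p =
        \<i> * of_real (\<Sum>n=1..N. a n * (q_int q (int n + 1) + q_int q (1 - int n)))"
      unfolding prod by (subst q_deriv_binomial_sum) (simp_all add: p sum_distrib_left algebra_simps)
    then have "\<bar>\<Sum>n=1..N. a n * (q_int q (int n + 1) + q_int q (1 - int n))\<bar> =
        norm (q_deriv q (\<lambda>x. f x * zpow 1 x) p)"
      by (simp only: norm_mult norm_ii norm_of_real mult_1)
    also have "\<dots> \<le> L_q q (\<lambda>x. f x * zpow 1 x)"
      unfolding L_q_def
      by (intro norm_le_sup_norm q_deriv_in_O_circle O_circle.mult f zpow_in_O_circle)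
    finally have "(\<Sum>n=1..N. a n * (q_int q (int n + 1) + q_int q (1 - int n)))
        \<le> L_q q (\<lambda>x. f x * zpow 1 x)" by linarith
    moreover have "\<delta> * (\<Sum>n=1..N. b n)
        \<le> (\<Sum>n=1..N. a n * (q_int q (int n + 1) + q_int q (1 - int n)))"
      unfolding sum_distrib_left
    proof (rule sum_mono)
      fix n assume n: "n \<in> {1..N}"
      have "\<delta> * b n = a n * (\<delta> * q_int q (int n))"
        using a_b[OF n] by (simp add: algebra_simps)
      also have "\<dots> \<le> a n * (q_int q (int n + 1) + q_int q (1 - int n))"
        unfolding \<delta>_def by (intro mult_left_mono q_int_diff_ge assms a_nonneg[OF n])
      finally show "\<delta> * b n \<le> a n * (q_int q (int n + 1) + q_int q (1 - int n))" .
    qed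
    ultimately show ?thesis by linarith
  qed

  ultimately have "\<delta> * (\<Sum>n=1..N. b n) \<le> C * (L_q q f + sup_norm f)"
    "L_q q f + sup_norm f \<le> B"
    using leibniz[OF f zpow_in_O_circle[of 1]] by (simp_all add: B_def)
  then have "\<delta> * (\<Sum>n=1..N. b n) \<le> C * B"
    using C by (meson mult_left_mono order_less_imp_le order_trans)
  then have "(\<Sum>n=1..N. b n) \<le> C * B / \<delta>"
    using \<delta> by (simp add: pos_le_divide_eq mult.commute)
  with large show False by (simp add: b_def)
qed

end
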